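(* Let $(X,\mathcal A)$ and $(Y,\mathcal B)$ be measurable spaces, $\nu$ a signed measure on $\mathcal A$, $\tau:X\to Y$ measurable, and $\pi:X\times Y\to Y$ given by $\pi(x,y)=y$. (a) There exists a signed measure $\tilde\mu$ on $(X\times Y,\mathcal A\otimes\mathcal B)$ for which $\tilde\mu(A\times B)=\nu(A\cap\tau^{-1}(B))$ for all $A\in\mathcal A$, $B\in\mathcal B$. (b) With $\tilde\mu$ as in (a): a kernel $\eta:Y\times\mathcal A\to\mathbb R$ is a regular conditional kernel under $\nu$ with respect to $\tau$ if and only if $\eta$ is a product regular conditional kernel under $\tilde\mu$ with respect to $\pi$.
   Context: A function $\eta:Y\times\mathcal A\to\mathbb R$ is a kernel if $\eta(\cdot,A)$ is $\mathcal B$-measurable for all $A\in\mathcal A$ and $\eta(y,\cdot)$ is a (finite, real-valued) signed measure for all $y\in Y$. $|\nu|$ denotes the total variation measure. A kernel $\eta$ is a regular conditional kernel under $\nu$ with respect to $\tau$ if $\nu(A\cap\tau^{-1}(B))=\int_Y\mathbf 1_B(y)\,\eta(y,A)\,d[|\nu|\circ\tau^{-1}](y)$ for all $A\in\mathcal A$, $B\in\mathcal B$. For a signed measure $\mu$ on $\mathcal A\otimes\mathcal B$, a kernel $\eta$ is a product regular conditional kernel under $\mu$ with respect to $\pi$ if $\mu(A\times B)=\int_Y\mathbf 1_B(y)\,\eta(y,A)\,d[|\mu|\circ\pi^{-1}](y)$ for all $A\in\mathcal A$, $B\in\mathcal B$. *)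

theory Defs
  imports "HOL-Analysis.Analysis"
begin

text \<open>
  A signed measure may take one of the two values \<open>\<infinity>\<close> and \<open>-\<infinity>\<close>. Only the measurable space of
  \<open>M\<close> matters here (its \<open>emeasure\<close> is ignored), and only the values of \<open>\<nu>\<close> on \<open>sets M\<close>.
\<close>

definition signed_measure :: "'a measure \<Rightarrow> ('a set \<Rightarrow> ereal) \<Rightarrow> bool" where
  "signed_measure M \<nu> \<longleftrightarrow>
     \<nu> {} = 0 \<and>
     ((\<forall>A\<in>sets M. \<nu> A \<noteq> \<infinity>) \<or> (\<forall>A\<in>sets M. \<nu> A \<noteq> -\<infinity>)) \<and>
     (\<forall>A :: nat \<Rightarrow> 'a set. range A \<subseteq> sets M \<longrightarrow> disjoint_family A \<longrightarrow>
        (\<lambda>i. \<nu> (A i)) sums \<nu> (\<Union>i. A i))"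

lemma signed_measure_Un:
  assumes "signed_measure M \<nu>" "A \<in> sets M" "B \<in> sets M" "A \<inter> B = {}"
  shows "\<nu> (A \<union> B) = \<nu> A + \<nu> B"
proof -
  let ?F = "binaryset A B"
  have "range ?F \<subseteq> sets M" "disjoint_family ?F"
    using assms by (auto simp: range_binaryset_eq disjoint_family_on_def binaryset_def)
  then have "(\<lambda>i. \<nu> (?F i)) sums \<nu> (A \<union> B)"
    using assms(1) unfolding signed_measure_def by (metis UN_binaryset_eq)
  moreover have "(\<lambda>i. \<nu> (?F i)) sums (\<nu> A + \<nu> B)"
    using assms(1) by (intro binaryset_sums) (simp add: signed_measure_def)
  ultimately show ?thesis
    by (rule sums_unique2)
qed

text \<open>
  Hence a signed measure with finite total mass is a real-valued one, and all statements about
  \<open>signed_measure\<close> specialise to finite signed measures.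
\<close>

lemma signed_measure_finite:
  assumes "signed_measure M \<nu>" "\<bar>\<nu> (space M)\<bar> \<noteq> \<infinity>" "A \<in> sets M"
  shows "\<bar>\<nu> A\<bar> \<noteq> \<infinity>"
proof -
  have "A \<union> (space M - A) = space M"
    using sets.sets_into_space[OF assms(3)] by blast
  then have "\<nu> (space M) = \<nu> A + \<nu> (space M - A)"
    using signed_measure_Un[OF assms(1,3), of "space M - A"] assms(3) by auto
  then show ?thesis
    using assms(2) by (cases "\<nu> A"; cases "\<nu> (space M - A)") auto
qed

text \<open>
  The total variation measure: the supremum of \<open>\<Sum>B\<in>P. \<bar>\<nu> B\<bar>\<close> over the finite measurable partitions
  \<open>P\<close> of a set. This set function is countably additive for every signed measure \<open>\<nu>\<close>, so it is
  the \<open>emeasure\<close> of the measure below on \<open>sets M\<close>.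
\<close>

definition total_variation :: "'a measure \<Rightarrow> ('a set \<Rightarrow> ereal) \<Rightarrow> 'a measure" where
  "total_variation M \<nu> =
     measure_of (space M) (sets M)
       (\<lambda>A. SUP P \<in> {P. finite P \<and> P \<subseteq> sets M \<and> partition_on A P}. \<Sum>B\<in>P. e2ennreal \<bar>\<nu> B\<bar>)"

text \<open>
  The integral of a real function exists and equals \<open>r\<close>, where \<open>r = \<plusminus>\<infinity>\<close> is allowed: the integrals
  of the positive and of the negative part are not both infinite, and \<open>r\<close> is their difference.
  (\<open>ennreal\<close> maps negative reals to \<open>0\<close>.)
\<close>

definition has_extended_integral :: "'a measure \<Rightarrow> ('a \<Rightarrow> real) \<Rightarrow> ereal \<Rightarrow> bool" where
  "has_extended_integral M f r \<longleftrightarrow>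
     f \<in> borel_measurable M \<and>
     ((\<integral>\<^sup>+ x. ennreal (f x) \<partial>M) \<noteq> \<infinity> \<or> (\<integral>\<^sup>+ x. ennreal (- f x) \<partial>M) \<noteq> \<infinity>) \<and>
     r = enn2ereal (\<integral>\<^sup>+ x. ennreal (f x) \<partial>M) - enn2ereal (\<integral>\<^sup>+ x. ennreal (- f x) \<partial>M)"

definition signed_kernel :: "'a measure \<Rightarrow> 'b measure \<Rightarrow> ('b \<Rightarrow> 'a set \<Rightarrow> real) \<Rightarrow> bool" where
  "signed_kernel X Y \<eta> \<longleftrightarrow>
     (\<forall>A\<in>sets X. (\<lambda>y. \<eta> y A) \<in> borel_measurable Y) \<and>
     (\<forall>y\<in>space Y. signed_measure X (\<lambda>A. ereal (\<eta> y A)))"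

definition regular_conditional_kernel ::
  "'a measure \<Rightarrow> 'b measure \<Rightarrow> ('a set \<Rightarrow> ereal) \<Rightarrow> ('a \<Rightarrow> 'b) \<Rightarrow> ('b \<Rightarrow> 'a set \<Rightarrow> real) \<Rightarrow> bool" where
  "regular_conditional_kernel X Y \<nu> \<tau> \<eta> \<longleftrightarrow>
     signed_kernel X Y \<eta> \<and>
     (\<forall>A\<in>sets X. \<forall>B\<in>sets Y.
        has_extended_integral (distr (total_variation X \<nu>) Y \<tau>)
          (\<lambda>y. indicator B y * \<eta> y A) (\<nu> (A \<inter> \<tau> -` B)))"

definition product_regular_conditional_kernel ::
  "'a measure \<Rightarrow> 'b measure \<Rightarrow> (('a \<times> 'b) set \<Rightarrow> ereal) \<Rightarrow> ('a \<times> 'b \<Rightarrow> 'b) \<Rightarrow>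
     ('b \<Rightarrow> 'a set \<Rightarrow> real) \<Rightarrow> bool" where
  "product_regular_conditional_kernel X Y \<mu> \<pi> \<eta> \<longleftrightarrow>
     signed_kernel X Y \<eta> \<and>
     (\<forall>A\<in>sets X. \<forall>B\<in>sets Y.
        has_extended_integral (distr (total_variation (X \<Otimes>\<^sub>M Y) \<mu>) Y \<pi>)
          (\<lambda>y. indicator B y * \<eta> y A) (\<mu> (A \<times> B)))"

end

theory Submission
  imports Defs
begin

text \<open>
  Let \<open>g x = (x, \<tau> x)\<close> be the graph map. The signed measure in the first part is the image of \<open>\<nu>\<close>
  under \<open>g\<close>. The second part then says that nothing relevant changes on passing to the image:
  the two defining identities prescribe the same values by assumption, and they involve the same
  integrals as soon as \<open>\<bar>\<nu>\<bar>\<close> and \<open>\<bar>\<mu>\<bar>\<close> have the same image on \<open>Y\<close>. Two facts have to be established.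

  First, the values on rectangles determine \<open>\<mu>\<close> (\<open>signed_measure_graph_unique\<close>). As \<open>\<nu>\<close> may be
  infinite without being \<open>\<sigma>\<close>-finite, the usual uniqueness theorem does not apply. Instead, \<open>\<mu>\<close>
  lives on the graph in the following sense: a rectangle which misses the graph has mass \<open>0\<close>, which
  is finite, so a Dynkin argument inside it shows that it is \<open>\<mu>\<close>-null. By induction on the
  generation of the \<open>\<sigma>\<close>-algebra, every measurable \<open>E\<close> then differs by a null set from the rectangle
  \<open>g\<^sup>-\<^sup>1(E) \<times> Y\<close>, so \<open>\<mu> E = \<nu> (g\<^sup>-\<^sup>1(E))\<close>. The graph itself need not be measurable.

  Second, \<open>\<bar>\<mu>\<bar>\<close> is the image of \<open>\<bar>\<nu>\<bar>\<close> under \<open>g\<close> (\<open>total_variation_image\<close>). For a general map the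
  variation of the image can be smaller, because of cancellation within the fibres, but \<open>g\<close> has the
  measurable left inverse \<open>(x, y) \<mapsto> x\<close>, so every partition of \<open>g\<^sup>-\<^sup>1(E)\<close> is pulled back from a
  partition of \<open>E\<close>. Composing with the projection to \<open>Y\<close> turns \<open>g\<close> into \<open>\<tau>\<close>.
\<close>

section \<open>Total variation under maps with a measurable left inverse\<close>

definition variation :: "'a measure \<Rightarrow> ('a set \<Rightarrow> ereal) \<Rightarrow> 'a set \<Rightarrow> ennreal" where
  "variation M \<nu> A =
     (SUP P \<in> {P. finite P \<and> P \<subseteq> sets M \<and> partition_on A P}. \<Sum>B\<in>P. e2ennreal \<bar>\<nu> B\<bar>)"

text \<open>
  Partitions have nonempty members that cover the whole set. Both restrictions are inconvenient when
  partitions are transported along maps; the supremum may equally be tested against indexed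
  families, possibly with empty members or an uncovered remainder.
\<close>

lemma sum_le_variation:
  assumes "\<nu> {} = 0" "finite I" "disjoint_family_on B I" "\<And>i. i \<in> I \<Longrightarrow> B i \<in> sets M"
    and "\<And>i. i \<in> I \<Longrightarrow> B i \<subseteq> E" "E \<in> sets M"
  shows "(\<Sum>i\<in>I. e2ennreal \<bar>\<nu> (B i)\<bar>) \<le> variation M \<nu> E"
proof -
  define J where "J = {i\<in>I. B i \<noteq> {}}"
  define P where "P = B ` J \<union> ({E - (\<Union>i\<in>I. B i)} - {{}})"
  have fin: "finite J"
    using assms(2) by (simp add: J_def)
  have inj: "inj_on B J"
  proof (rule inj_onI, rule ccontr)
    fix i j assume "i \<in> J" "j \<in> J" "B i = B j" "i \<noteq> j"
    then show False
      using disjoint_family_onD[OF assms(3), of i j] by (simp add: J_def)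
  qed
  have "partition_on E P"
  proof (rule partition_onI)
    have "\<Union>P = \<Union>(B ` J) \<union> (E - (\<Union>i\<in>I. B i))"
      unfolding P_def Union_Un_distrib by auto
    moreover have "\<Union>(B ` J) = (\<Union>i\<in>I. B i)"
      by (auto simp: J_def)
    moreover have "(\<Union>i\<in>I. B i) \<subseteq> E"
      by (rule UN_least) (rule assms(5))
    ultimately show "\<Union>P = E"
      by (simp add: Un_absorb1)
    show "{} \<notin> P"
      by (auto simp: P_def J_def)
    show "disjnt p q" if "p \<in> P" "q \<in> P" "p \<noteq> q" for p q
    proof -
      have "disjnt (B i) (B j)" if "i \<in> J" "j \<in> J" "B i \<noteq> B j" for i j
        using that disjoint_family_onD[OF assms(3), of i j] by (auto simp: J_def disjnt_def)
      moreover have "disjnt (B i) (E - (\<Union>i\<in>I. B i))" if "i \<in> J" for i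
        using that unfolding J_def disjnt_def by blast
      ultimately show ?thesis
        using that unfolding P_def by (blast intro: disjnt_sym)
    qed
  qed
  moreover have "finite P"
    using fin by (simp add: P_def)
  moreover have "P \<subseteq> sets M"
  proof -
    have "(\<Union>i\<in>I. B i) \<in> sets M"
      using assms(2,4) by (rule sets.finite_UN)
    then show ?thesis
      using assms(4,6) by (auto simp: P_def J_def)
  qed
  ultimately have P: "(\<Sum>C\<in>P. e2ennreal \<bar>\<nu> C\<bar>) \<le> variation M \<nu> E"
    unfolding variation_def by (intro SUP_upper) auto
  have "(\<Sum>i\<in>I. e2ennreal \<bar>\<nu> (B i)\<bar>) = (\<Sum>i\<in>J. e2ennreal \<bar>\<nu> (B i)\<bar>)"
    using assms(1,2) by (intro sum.mono_neutral_right) (auto simp: J_def zero_ennreal.abs_eq[symmetric])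
  also have "\<dots> = (\<Sum>C\<in>B ` J. e2ennreal \<bar>\<nu> C\<bar>)"
    using inj by (simp add: sum.reindex)
  also have "\<dots> \<le> (\<Sum>C\<in>P. e2ennreal \<bar>\<nu> C\<bar>)"
    using \<open>finite P\<close> by (intro sum_mono2) (auto simp: P_def)
  finally show ?thesis
    using P by simp
qed

lemma variation_cong:
  assumes "\<And>B. B \<in> sets M \<Longrightarrow> \<nu> B = \<nu>' B"
  shows "variation M \<nu> A = variation M \<nu>' A"
  unfolding variation_def using assms by (intro SUP_cong refl sum.cong) (auto simp: subset_iff)

lemma variation_empty: "variation M \<nu> {} = 0"
proof -
  have "{P. finite P \<and> P \<subseteq> sets M \<and> partition_on {} P} = {{}}"
    by (auto simp: partition_on_def)
  then show ?thesis
    by (simp add: variation_def)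
qed

lemma variation_image:
  assumes g: "g \<in> measurable M N" and h: "h \<in> measurable N M"
    and inv: "\<And>x. x \<in> space M \<Longrightarrow> h (g x) = x"
    and empty: "\<nu> {} = 0" and E: "E \<in> sets N"
  shows "variation N (\<lambda>E. \<nu> (g -` E \<inter> space M)) E = variation M \<nu> (g -` E \<inter> space M)"
proof (rule antisym)
  have gE: "g -` E \<inter> space M \<in> sets M"
    using g E by (rule measurable_sets)
  show "variation N (\<lambda>E. \<nu> (g -` E \<inter> space M)) E \<le> variation M \<nu> (g -` E \<inter> space M)"
    unfolding variation_def[of N]
  proof (rule SUP_least)
    fix P assume "P \<in> {P. finite P \<and> P \<subseteq> sets N \<and> partition_on E P}"
    then have P: "finite P" "P \<subseteq> sets N" "partition_on E P"
      by auto
    show "(\<Sum>B\<in>P. e2ennreal \<bar>\<nu> (g -` B \<inter> space M)\<bar>) \<le> variation M \<nu> (g -` E \<inter> space M)"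
    proof (rule sum_le_variation[where B = "\<lambda>B. g -` B \<inter> space M"])
      show "disjoint_family_on (\<lambda>B. g -` B \<inter> space M) P"
        using disjointD[OF partition_onD2[OF P(3)]] by (force simp: disjoint_family_on_def)
      show "g -` B \<inter> space M \<in> sets M" if "B \<in> P" for B
        using that P(2) g by (auto intro: measurable_sets)
      show "g -` B \<inter> space M \<subseteq> g -` E \<inter> space M" if "B \<in> P" for B
        using that P(3) by (auto simp: partition_on_def)
    qed (use P empty gE in auto)
  qed
  show "variation M \<nu> (g -` E \<inter> space M) \<le> variation N (\<lambda>E. \<nu> (g -` E \<inter> space M)) E"
    unfolding variation_def[of M]
  proof (rule SUP_least)
    fix P assume "P \<in> {P. finite P \<and> P \<subseteq> sets M \<and> partition_on (g -` E \<inter> space M) P}"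
    then have P: "finite P" "P \<subseteq> sets M" "partition_on (g -` E \<inter> space M) P"
      by auto
    \<comment> \<open>The set \<open>E \<inter> h\<^sup>-\<^sup>1(B)\<close> is a measurable part of \<open>E\<close> whose preimage is exactly \<open>B\<close>. These parts
      leave uncovered the points of \<open>E\<close> that \<open>h\<close> sends outside the preimage of \<open>E\<close>.\<close>
    define F where "F B = E \<inter> (h -` B \<inter> space N)" for B
    have F: "g -` F B \<inter> space M = B" if "B \<in> P" for B
    proof -
      have "B \<subseteq> g -` E \<inter> space M"
        using that P(3) by (auto simp: partition_on_def)
      then show ?thesis
        using inv measurable_space[OF g] by (auto simp: F_def)
    qed
    have "(\<Sum>B\<in>P. e2ennreal \<bar>\<nu> B\<bar>) = (\<Sum>B\<in>P. e2ennreal \<bar>\<nu> (g -` F B \<inter> space M)\<bar>)"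
      by (intro sum.cong) (simp_all add: F)
    also have "\<dots> \<le> variation N (\<lambda>E. \<nu> (g -` E \<inter> space M)) E"
    proof (rule sum_le_variation[where B = F])
      show "disjoint_family_on F P"
        using disjointD[OF partition_onD2[OF P(3)]]
        by (force simp: disjoint_family_on_def F_def)
      show "F B \<in> sets N" if "B \<in> P" for B
        using that P(2) E measurable_sets[OF h, of B] by (auto simp: F_def)
    qed (use P E empty in \<open>auto simp: F_def\<close>)
    finally show "(\<Sum>B\<in>P. e2ennreal \<bar>\<nu> B\<bar>) \<le> variation N (\<lambda>E. \<nu> (g -` E \<inter> space M)) E" .
  qed
qed

lemma space_total_variation [simp]: "space (total_variation M \<nu>) = space M"
  by (simp add: total_variation_def space_measure_of_conv)

lemma sets_total_variation [simp, measurable_cong]: "sets (total_variation M \<nu>) = sets M"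
  by (simp add: total_variation_def sets.sigma_sets_eq sets.space_closed)

text \<open>
  The default value \<open>0\<close> is the one \<open>measure_of\<close> assigns when the set function is not countably
  additive. The condition is kept in the formula because it can be carried through
  \<open>total_variation_image\<close> by a symmetric argument.
\<close>

lemma emeasure_total_variation:
  "emeasure (total_variation M \<nu>) A =
     (if A \<in> sets M \<and> countably_additive (sets M) (variation M \<nu>) then variation M \<nu> A else 0)"
proof -
  have "total_variation M \<nu> = measure_of (space M) (sets M) (variation M \<nu>)"
    unfolding total_variation_def by (simp add: variation_def[abs_def])
  then show ?thesis
    by (simp add: emeasure_measure_of_conv sets.sigma_sets_eq measure_space_def
        sets.sigma_algebra_axioms positive_def variation_empty)
qed

lemma total_variation_cong:
  assumes "\<And>B. B \<in> sets M \<Longrightarrow> \<nu> B = \<nu>' B"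
  shows "total_variation M \<nu> = total_variation M \<nu>'"
proof -
  have "variation M \<nu> = variation M \<nu>'"
    by (rule ext) (rule variation_cong[OF assms])
  then show ?thesis
    by (intro measure_eqI) (simp_all add: emeasure_total_variation)
qed

text \<open>
  The measures agree because their values on measurable sets do, once it is known that the variation
  of \<open>\<nu>\<close> is countably additive exactly when that of the image is: disjoint sequences are carried
  from \<open>N\<close> to \<open>M\<close> by preimages under \<open>g\<close>, and back by preimages under \<open>h\<close>.
\<close>

lemma total_variation_image:
  assumes g: "g \<in> measurable M N" and h: "h \<in> measurable N M"
    and inv: "\<And>x. x \<in> space M \<Longrightarrow> h (g x) = x"
    and empty: "\<nu> {} = 0"
  shows "total_variation N (\<lambda>E. \<nu> (g -` E \<inter> space M)) = distr (total_variation M \<nu>) N g"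
proof -
  let ?\<mu> = "\<lambda>E. \<nu> (g -` E \<inter> space M)"
  have image: "variation N ?\<mu> E = variation M \<nu> (g -` E \<inter> space M)" if "E \<in> sets N" for E
    using inv empty that by (rule variation_image[OF g h])
  have "countably_additive (sets N) (variation N ?\<mu>) \<longleftrightarrow>
      countably_additive (sets M) (variation M \<nu>)"
  proof
    assume add: "countably_additive (sets N) (variation N ?\<mu>)"
    show "countably_additive (sets M) (variation M \<nu>)"
      unfolding countably_additive_def
    proof (intro allI impI)
      fix A :: "nat \<Rightarrow> 'a set"
      assume A: "range A \<subseteq> sets M" "disjoint_family A" "(\<Union>i. A i) \<in> sets M"
      define E where "E B = h -` B \<inter> space N" for B
      have E: "E B \<in> sets N" if "B \<in> sets M" for B
        using h that unfolding E_def by (rule measurable_sets)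
      have "g -` E B \<inter> space M = B" if "B \<in> sets M" for B
        using sets.sets_into_space[OF that] inv measurable_space[OF g] by (auto simp: E_def)
      then have var: "variation N ?\<mu> (E B) = variation M \<nu> B" if "B \<in> sets M" for B
        using image[OF E[OF that]] that by simp
      have "range (\<lambda>i. E (A i)) \<subseteq> sets N" "disjoint_family (\<lambda>i. E (A i))"
        using A E by (auto simp: disjoint_family_on_def E_def)
      moreover have "(\<Union>i. E (A i)) = E (\<Union>i. A i)"
        by (auto simp: E_def)
      ultimately have "(\<Sum>i. variation N ?\<mu> (E (A i))) = variation N ?\<mu> (E (\<Union>i. A i))"
        using add E[OF A(3)] unfolding countably_additive_def by metis
      then show "(\<Sum>i. variation M \<nu> (A i)) = variation M \<nu> (\<Union>i. A i)"
        using A by (simp add: var range_subsetD)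
    qed
  next
    assume add: "countably_additive (sets M) (variation M \<nu>)"
    show "countably_additive (sets N) (variation N ?\<mu>)"
      unfolding countably_additive_def
    proof (intro allI impI)
      fix E :: "nat \<Rightarrow> 'b set"
      assume E: "range E \<subseteq> sets N" "disjoint_family E" "(\<Union>i. E i) \<in> sets N"
      define A where "A B = g -` B \<inter> space M" for B
      have A: "A B \<in> sets M" if "B \<in> sets N" for B
        using g that unfolding A_def by (rule measurable_sets)
      have "range (\<lambda>i. A (E i)) \<subseteq> sets M" "disjoint_family (\<lambda>i. A (E i))"
        using E A by (auto simp: disjoint_family_on_def A_def)
      moreover have "(\<Union>i. A (E i)) = A (\<Union>i. E i)"
        by (auto simp: A_def)
      ultimately have "(\<Sum>i. variation M \<nu> (A (E i))) = variation M \<nu> (A (\<Union>i. E i))"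
        using add A[OF E(3)] unfolding countably_additive_def by metis
      then show "(\<Sum>i. variation N ?\<mu> (E i)) = variation N ?\<mu> (\<Union>i. E i)"
        using E by (simp add: image range_subsetD A_def)
    qed
  qed
  moreover have "emeasure (distr (total_variation M \<nu>) N g) E =
      emeasure (total_variation M \<nu>) (g -` E \<inter> space M)" if "E \<in> sets N" for E
    using g that by (subst emeasure_distr) auto
  ultimately show ?thesis
    using measurable_sets[OF g]
    by (intro measure_eqI) (auto simp: emeasure_total_variation image)
qed

section \<open>Images and null sets of signed measures\<close>

lemma signed_measure_sums:
  assumes "signed_measure M \<mu>" "\<And>i :: nat. A i \<in> sets M" "disjoint_family A"
  shows "(\<lambda>i. \<mu> (A i)) sums \<mu> (\<Union>i. A i)"
  using assms unfolding signed_measure_def by blast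

lemma signed_measure_image:
  assumes \<nu>: "signed_measure M \<nu>" and g: "g \<in> measurable M N"
  shows "signed_measure N (\<lambda>E. \<nu> (g -` E \<inter> space M))"
  unfolding signed_measure_def
proof (intro conjI allI impI)
  show "\<nu> (g -` {} \<inter> space M) = 0"
    using \<nu> by (simp add: signed_measure_def)
  show "(\<forall>E\<in>sets N. \<nu> (g -` E \<inter> space M) \<noteq> \<infinity>) \<or> (\<forall>E\<in>sets N. \<nu> (g -` E \<inter> space M) \<noteq> - \<infinity>)"
    using \<nu> measurable_sets[OF g] unfolding signed_measure_def by blast
  fix E :: "nat \<Rightarrow> 'b set"
  assume E: "range E \<subseteq> sets N" "disjoint_family E"
  have "(\<lambda>i. \<nu> (g -` E i \<inter> space M)) sums \<nu> (\<Union>i. g -` E i \<inter> space M)"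
    using E measurable_sets[OF g]
    by (intro signed_measure_sums[OF \<nu>]) (auto simp: disjoint_family_on_def)
  moreover have "(\<Union>i. g -` E i \<inter> space M) = g -` (\<Union>i. E i) \<inter> space M"
    by auto
  ultimately show "(\<lambda>i. \<nu> (g -` E i \<inter> space M)) sums \<nu> (g -` (\<Union>i. E i) \<inter> space M)"
    by simp
qed

text \<open>
  Null sets are taken in the hereditary sense: positive and negative parts may cancel, so a set of
  mass \<open>0\<close> need not be negligible.
\<close>

definition signed_null :: "'a measure \<Rightarrow> ('a set \<Rightarrow> ereal) \<Rightarrow> 'a set \<Rightarrow> bool" where
  "signed_null M \<mu> E \<longleftrightarrow> E \<in> sets M \<and> (\<forall>F\<in>sets M. F \<subseteq> E \<longrightarrow> \<mu> F = 0)"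

lemma signed_null_subset:
  "signed_null M \<mu> E \<Longrightarrow> F \<in> sets M \<Longrightarrow> F \<subseteq> E \<Longrightarrow> signed_null M \<mu> F"
  by (auto simp: signed_null_def)

lemma signed_null_UN:
  assumes \<mu>: "signed_measure M \<mu>" and E: "\<And>i :: nat. signed_null M \<mu> (E i)"
  shows "signed_null M \<mu> (\<Union>i. E i)"
proof -
  have sets: "E i \<in> sets M" for i
    using E by (simp add: signed_null_def)
  have "\<mu> F = 0" if F: "F \<in> sets M" "F \<subseteq> (\<Union>i. E i)" for F
  proof -
    define G where "G i = F \<inter> disjointed E i" for i
    have G: "G i \<in> sets M" for i
      using F(1) sets sets.range_disjointed_sets[of E M] by (auto simp: G_def)
    have "disjoint_family G"
      using disjoint_family_disjointed[of E] by (auto simp: disjoint_family_on_def G_def)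
    then have "(\<lambda>i. \<mu> (G i)) sums \<mu> (\<Union>i. G i)"
      using \<mu> G by (intro signed_measure_sums)
    moreover have "(\<Union>i. G i) = F"
      using F(2) UN_disjointed_eq[of E] by (auto simp: G_def)
    moreover have "\<mu> (G i) = 0" for i
      using E[of i] G[of i] disjointed_subset[of E i] by (auto simp: G_def signed_null_def)
    ultimately show ?thesis
      using sums_unique2[OF _ sums_zero] by simp
  qed
  then show ?thesis
    using sets by (auto simp: signed_null_def)
qed

lemma signed_null_Un:
  assumes "signed_measure M \<mu>" "signed_null M \<mu> A" "signed_null M \<mu> B"
  shows "signed_null M \<mu> (A \<union> B)"
proof -
  have "signed_null M \<mu> (binaryset A B i)" for i
  proof (cases "i = 0 \<or> i = 1")
    case False
    then show ?thesis
      using assms(2) by (auto simp: binaryset_def intro: signed_null_subset)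
  qed (use assms(2,3) in \<open>auto simp: binaryset_def\<close>)
  then show ?thesis
    using signed_null_UN[OF assms(1)] by (metis UN_binaryset_eq)
qed

lemma signed_measure_null_diff:
  assumes \<mu>: "signed_measure M \<mu>" and A: "A \<in> sets M" and B: "B \<in> sets M"
    and null: "signed_null M \<mu> (A - B)" "signed_null M \<mu> (B - A)"
  shows "\<mu> A = \<mu> B"
proof -
  have split: "\<mu> C = \<mu> (C \<inter> D) + \<mu> (C - D)" if "C \<in> sets M" "D \<in> sets M" for C D
    using that signed_measure_Un[OF \<mu>, of "C \<inter> D" "C - D"] by (simp add: Int_Diff_Un Int_Diff_disjoint)
  have "\<mu> A = \<mu> (A \<inter> B)" "\<mu> B = \<mu> (A \<inter> B)"
    using split[OF A B] split[OF B A] null by (simp_all add: signed_null_def Int_commute)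
  then show ?thesis
    by simp
qed

section \<open>Signed measures carried by a graph\<close>

text \<open>
  All subrectangles of a rectangle that misses the graph have mass \<open>0\<close>. As this includes the
  rectangle itself, passing to complements inside it involves no infinite values, and the
  \<open>\<pi>\<close>-\<open>\<lambda>\<close> argument goes through although \<open>\<mu>\<close> may be infinite elsewhere.
\<close>

lemma signed_null_rectangle:
  assumes \<mu>: "signed_measure (X \<Otimes>\<^sub>M Y) \<mu>"
    and rect: "\<And>A B. A \<in> sets X \<Longrightarrow> B \<in> sets Y \<Longrightarrow> \<mu> (A \<times> B) = \<nu> (A \<inter> \<tau> -` B)"
    and \<nu>: "\<nu> {} = 0"
    and A: "A \<in> sets X" and B: "B \<in> sets Y" and disj: "A \<inter> \<tau> -` B = {}"
  shows "signed_null (X \<Otimes>\<^sub>M Y) \<mu> (A \<times> B)"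
proof -
  let ?G = "{a \<times> b | a b. a \<in> sets X \<and> b \<in> sets Y}"
  have zero: "\<mu> (A' \<times> B') = 0"
    if "A' \<in> sets X" "B' \<in> sets Y" "A' \<subseteq> A" "B' \<subseteq> B" for A' B'
  proof -
    have "A' \<inter> \<tau> -` B' = {}"
      using that disj by auto
    then show ?thesis
      using rect[OF that(1,2)] \<nu> by simp
  qed
  have meas: "A \<times> B \<in> sets (X \<Otimes>\<^sub>M Y)"
    using A B by simp
  have "\<mu> (E \<inter> (A \<times> B)) = 0" if "E \<in> sets (X \<Otimes>\<^sub>M Y)" for E
  proof -
    have "E \<in> sigma_sets (space X \<times> space Y) ?G"
      using that by (simp add: sets_pair_measure)
    then show ?thesis
    proof (induction rule: sigma_sets_induct_disjoint[OF Int_stable_pair_measure_generator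
            pair_measure_closed, consumes 1, case_names basic empty compl union])
      case (basic E)
      then obtain a b where E: "E = a \<times> b" "a \<in> sets X" "b \<in> sets Y"
        by auto
      then have "E \<inter> (A \<times> B) = (a \<inter> A) \<times> (b \<inter> B)"
        by auto
      then show ?case
        using E A B by (simp add: zero)
    next
      case empty
      then show ?case
        using \<mu> by (simp add: signed_measure_def)
    next
      case (compl E)
      have E: "E \<in> sets (X \<Otimes>\<^sub>M Y)"
        using compl by (simp add: sets_pair_measure)
      have comp: "(space X \<times> space Y - E) \<inter> (A \<times> B) = A \<times> B - E"
        using sets.sets_into_space[OF A] sets.sets_into_space[OF B] by auto
      have "\<mu> (A \<times> B) = \<mu> (E \<inter> (A \<times> B)) + \<mu> (A \<times> B - E)"
        using signed_measure_Un[OF \<mu>, of "E \<inter> (A \<times> B)" "A \<times> B - E"] E meas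
        by (simp add: Int_Diff_Un Int_Diff_disjoint Int_commute[of E])
      then show ?case
        using compl.IH zero[OF A B] comp by simp
    next
      case (union E)
      have E: "E i \<in> sets (X \<Otimes>\<^sub>M Y)" for i
        using union by (auto simp: sets_pair_measure)
      have "disjoint_family (\<lambda>i. E i \<inter> (A \<times> B))"
        using union by (auto simp: disjoint_family_on_def)
      then have "(\<lambda>i. \<mu> (E i \<inter> (A \<times> B))) sums \<mu> (\<Union>i. E i \<inter> (A \<times> B))"
        using E meas by (intro signed_measure_sums[OF \<mu>]) auto
      then have "\<mu> (\<Union>i. E i \<inter> (A \<times> B)) = 0"
        using sums_unique2[OF _ sums_zero] union.IH by simp
      then show ?case
        by (simp only: Int_UN_distrib2 UN_extend_simps)
    qed
  qed
  from this[of F for F] show ?thesis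
    using meas by (metis signed_null_def inf.absorb1)
qed

text \<open>
  A null set separates \<open>E\<close> from the rectangle over its trace on the graph. For a rectangle
  \<open>E = a \<times> b\<close>, the symmetric difference consists of two rectangles that miss the graph; complements
  do not change the symmetric difference, and for countable unions it is contained in the union of
  the symmetric differences.
\<close>

lemma signed_null_graph_trace:
  assumes \<tau>: "\<tau> \<in> measurable X Y"
    and \<mu>: "signed_measure (X \<Otimes>\<^sub>M Y) \<mu>"
    and rect: "\<And>A B. A \<in> sets X \<Longrightarrow> B \<in> sets Y \<Longrightarrow> \<mu> (A \<times> B) = \<nu> (A \<inter> \<tau> -` B)"
    and \<nu>: "\<nu> {} = 0"
    and E: "E \<in> sets (X \<Otimes>\<^sub>M Y)"
  defines "T \<equiv> \<lambda>E. ((\<lambda>x. (x, \<tau> x)) -` E \<inter> space X) \<times> space Y"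
  shows "signed_null (X \<Otimes>\<^sub>M Y) \<mu> ((E - T E) \<union> (T E - E))"
proof -
  have g: "(\<lambda>x. (x, \<tau> x)) \<in> measurable X (X \<Otimes>\<^sub>M Y)"
    using \<tau> by simp
  have T: "T E \<in> sets (X \<Otimes>\<^sub>M Y)" if "E \<in> sets (X \<Otimes>\<^sub>M Y)" for E
    using measurable_sets[OF g that] by (simp add: T_def)
  have "E \<in> sigma_sets (space X \<times> space Y) {a \<times> b | a b. a \<in> sets X \<and> b \<in> sets Y}"
    using E by (simp add: sets_pair_measure)
  then show ?thesis
  proof induction
    case (Basic E)
    then obtain a b where E: "E = a \<times> b" "a \<in> sets X" "b \<in> sets Y"
      by auto
    define c where "c = a \<inter> (\<tau> -` b \<inter> space X)"
    have c: "c \<in> sets X"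
      using E measurable_sets[OF \<tau>, of b] by (simp add: c_def)
    have "signed_null (X \<Otimes>\<^sub>M Y) \<mu> ((a - c) \<times> b)"
      using E c sets.sets_into_space[OF E(2)]
      by (intro signed_null_rectangle[OF \<mu> rect \<nu>]) (auto simp: c_def)
    moreover have "signed_null (X \<Otimes>\<^sub>M Y) \<mu> (c \<times> (space Y - b))"
      using E c by (intro signed_null_rectangle[OF \<mu> rect \<nu>]) (auto simp: c_def)
    moreover have "(E - T E) \<union> (T E - E) = ((a - c) \<times> b) \<union> (c \<times> (space Y - b))"
      using sets.sets_into_space[OF E(2)] sets.sets_into_space[OF E(3)]
      by (auto simp: E(1) c_def T_def)
    ultimately show ?case
      using signed_null_Un[OF \<mu>] by metis
  next
    case Empty
    then show ?case
      using \<mu> by (simp add: T_def signed_null_def signed_measure_def)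
  next
    case (Compl E)
    have "E \<subseteq> space X \<times> space Y"
      using Compl.hyps sigma_sets_into_sp[OF pair_measure_closed] by blast
    then have "(space X \<times> space Y - E - T (space X \<times> space Y - E)) \<union>
        (T (space X \<times> space Y - E) - (space X \<times> space Y - E)) = (E - T E) \<union> (T E - E)"
      using measurable_space[OF \<tau>] by (auto simp: T_def)
    then show ?case
      using Compl.IH by simp
  next
    case (Union E)
    have E: "E i \<in> sets (X \<Otimes>\<^sub>M Y)" for i
      using Union.hyps by (simp add: sets_pair_measure)
    then have U: "(\<Union>i. E i) \<in> sets (X \<Otimes>\<^sub>M Y)"
      by auto
    have "((\<Union>i. E i) - T (\<Union>i. E i)) \<union> (T (\<Union>i. E i) - (\<Union>i. E i))
        \<subseteq> (\<Union>i. (E i - T (E i)) \<union> (T (E i) - E i))"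
      by (auto simp: T_def)
    then show ?case
      using U T[OF U] by (intro signed_null_subset[OF signed_null_UN[OF \<mu> Union.IH]]) auto
  qed
qed

lemma signed_measure_graph_unique:
  assumes \<tau>: "\<tau> \<in> measurable X Y"
    and \<mu>: "signed_measure (X \<Otimes>\<^sub>M Y) \<mu>"
    and rect: "\<And>A B. A \<in> sets X \<Longrightarrow> B \<in> sets Y \<Longrightarrow> \<mu> (A \<times> B) = \<nu> (A \<inter> \<tau> -` B)"
    and \<nu>: "\<nu> {} = 0"
    and E: "E \<in> sets (X \<Otimes>\<^sub>M Y)"
  shows "\<mu> E = \<nu> ((\<lambda>x. (x, \<tau> x)) -` E \<inter> space X)"
proof -
  let ?A = "(\<lambda>x. (x, \<tau> x)) -` E \<inter> space X"
  have A: "?A \<in> sets X"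
    using \<tau> E by (intro measurable_sets[of _ X "X \<Otimes>\<^sub>M Y"]) simp_all
  then have R: "?A \<times> space Y \<in> sets (X \<Otimes>\<^sub>M Y)"
    by simp
  note null = signed_null_graph_trace[OF \<tau> \<mu> rect \<nu> E]
  have "\<mu> E = \<mu> (?A \<times> space Y)"
    using E R by (intro signed_measure_null_diff[OF \<mu>] signed_null_subset[OF null]) auto
  also have "\<dots> = \<nu> (?A \<inter> \<tau> -` space Y)"
    using rect[OF A sets.top] .
  also have "?A \<inter> \<tau> -` space Y = ?A"
    using measurable_space[OF \<tau>] by auto
  finally show ?thesis .
qed

section \<open>Conditional kernels and product conditional kernels\<close>

theorem theorem3p6:
  fixes X :: "'a measure" and Y :: "'b measure"
    and \<nu> :: "'a set \<Rightarrow> ereal" and \<tau> :: "'a \<Rightarrow> 'b"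
  assumes "signed_measure X \<nu>"
    and "\<tau> \<in> measurable X Y"
  shows "(\<exists>\<mu>. signed_measure (X \<Otimes>\<^sub>M Y) \<mu> \<and>
            (\<forall>A\<in>sets X. \<forall>B\<in>sets Y. \<mu> (A \<times> B) = \<nu> (A \<inter> \<tau> -` B))) \<and>
         (\<forall>\<mu>. signed_measure (X \<Otimes>\<^sub>M Y) \<mu> \<and>
            (\<forall>A\<in>sets X. \<forall>B\<in>sets Y. \<mu> (A \<times> B) = \<nu> (A \<inter> \<tau> -` B)) \<longrightarrow>
            (\<forall>\<eta>. signed_kernel X Y \<eta> \<longrightarrow>
               (regular_conditional_kernel X Y \<nu> \<tau> \<eta> \<longleftrightarrow>
                product_regular_conditional_kernel X Y \<mu> (\<lambda>(x, y). y) \<eta>)))"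
proof (intro conjI allI impI)
  define g where "g = (\<lambda>x. (x, \<tau> x))"
  have g: "g \<in> measurable X (X \<Otimes>\<^sub>M Y)"
    using assms(2) by (simp add: g_def)
  have \<nu>: "\<nu> {} = 0"
    using assms(1) by (simp add: signed_measure_def)
  show "\<exists>\<mu>. signed_measure (X \<Otimes>\<^sub>M Y) \<mu> \<and>
      (\<forall>A\<in>sets X. \<forall>B\<in>sets Y. \<mu> (A \<times> B) = \<nu> (A \<inter> \<tau> -` B))"
  proof (intro exI conjI ballI)
    show "signed_measure (X \<Otimes>\<^sub>M Y) (\<lambda>E. \<nu> (g -` E \<inter> space X))"
      using assms(1) g by (rule signed_measure_image)
    fix A B assume "A \<in> sets X" "B \<in> sets Y"
    then have "g -` (A \<times> B) \<inter> space X = A \<inter> \<tau> -` B"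
      using sets.sets_into_space[of A X] by (auto simp: g_def)
    then show "\<nu> (g -` (A \<times> B) \<inter> space X) = \<nu> (A \<inter> \<tau> -` B)"
      by simp
  qed
  fix \<mu> and \<eta> :: "'b \<Rightarrow> 'a set \<Rightarrow> real"
  assume \<mu>: "signed_measure (X \<Otimes>\<^sub>M Y) \<mu> \<and>
      (\<forall>A\<in>sets X. \<forall>B\<in>sets Y. \<mu> (A \<times> B) = \<nu> (A \<inter> \<tau> -` B))"
  have "total_variation (X \<Otimes>\<^sub>M Y) \<mu> =
      total_variation (X \<Otimes>\<^sub>M Y) (\<lambda>E. \<nu> (g -` E \<inter> space X))"
  proof (rule total_variation_cong)
    fix E assume E: "E \<in> sets (X \<Otimes>\<^sub>M Y)"
    show "\<mu> E = \<nu> (g -` E \<inter> space X)"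
      unfolding g_def
    proof (rule signed_measure_graph_unique)
      show "\<mu> (A \<times> B) = \<nu> (A \<inter> \<tau> -` B)" if "A \<in> sets X" "B \<in> sets Y" for A B
        using \<mu> that by blast
    qed (use \<mu> \<nu> E assms(2) in simp_all)
  qed
  also have "\<dots> = distr (total_variation X \<nu>) (X \<Otimes>\<^sub>M Y) g"
    using g \<nu> by (intro total_variation_image[where h = fst]) (auto simp: g_def)
  finally have "distr (total_variation (X \<Otimes>\<^sub>M Y) \<mu>) Y (\<lambda>(x, y). y) =
      distr (distr (total_variation X \<nu>) (X \<Otimes>\<^sub>M Y) g) Y (\<lambda>(x, y). y)"
    by simp
  also have "\<dots> = distr (total_variation X \<nu>) Y ((\<lambda>(x, y). y) \<circ> g)"
    using g by (intro distr_distr) auto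
  also have "(\<lambda>(x, y). y) \<circ> g = \<tau>"
    by (auto simp: g_def)
  finally show "regular_conditional_kernel X Y \<nu> \<tau> \<eta> \<longleftrightarrow>
      product_regular_conditional_kernel X Y \<mu> (\<lambda>(x, y). y) \<eta>"
    using \<mu> by (simp add: regular_conditional_kernel_def product_regular_conditional_kernel_def)
qed

end
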